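(* Let $F$ be a finite field of characteristic $2$, let $n\ge m\ge 1$, and let $G$ be a finite nonabelian $2$-group given by a central extension $$1\longrightarrow \mathbb{Z}_{2^n}\times \mathbb{Z}_{2^m}\longrightarrow G\longrightarrow \mathbb{Z}_2\times\cdots\times\mathbb{Z}_2\longrightarrow 1$$ with derived subgroup $G'\cong\mathbb{Z}_2$. Then the order of $V_*(FG)$ is divisible by $|F|^{\frac12(|G|+|\Omega_1(G)|)-1}$.
   Context: For a finite $2$-group $G$ and a finite field $F$ of characteristic $2$, $V(FG)=\{\sum_{g\in G}\alpha_g g\in FG : \sum_{g}\alpha_g=1\}$ is the group of normalized units of the group algebra $FG$. For $x=\sum_{g}\alpha_g g$ put $x^*=\sum_g\alpha_g g^{-1}$. The unitary subgroup is $V_*(FG)=\{x\in V(FG): x^*=x^{-1}\}$. $\Omega_1(G)$ denotes the set $\{g\in G: g^2=1\}$. A central extension means that the image of $\mathbb{Z}_{2^n}\times\mathbb{Z}_{2^m}$ lies in the center of $G$; the quotient is an elementary abelian $2$-group. *)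

theory Defs
  imports "HOL-Algebra.Algebra"
begin

text \<open>Characteristic of a ring in the carrier-based setting; 0 if no positive
  multiple of the identity vanishes.\<close>

definition ring_characteristic :: "('a, 'b) ring_scheme \<Rightarrow> nat" where
  "ring_characteristic R =
     (if \<exists>n::nat. 0 < n \<and> [n] \<cdot>\<^bsub>R\<^esub> \<one>\<^bsub>R\<^esub> = \<zero>\<^bsub>R\<^esub>
      then LEAST n::nat. 0 < n \<and> [n] \<cdot>\<^bsub>R\<^esub> \<one>\<^bsub>R\<^esub> = \<zero>\<^bsub>R\<^esub>
      else 0)"

text \<open>The group algebra of a finite group \<open>G\<close> over \<open>F\<close>: an element
  \<open>\<Sum>g. \<alpha>\<^sub>g g\<close> is its coefficient function \<open>g \<mapsto> \<alpha>\<^sub>g\<close>, extensional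
  on the carrier of \<open>G\<close>.  In the product, the coefficient of \<open>g\<close> collects the pairs
  \<open>(h, h\<inverse> g)\<close>.\<close>

definition group_algebra ::
    "('f, 'a) ring_scheme \<Rightarrow> ('g, 'b) monoid_scheme \<Rightarrow> ('g \<Rightarrow> 'f) ring" where
  "group_algebra F G =
     \<lparr>carrier = carrier G \<rightarrow>\<^sub>E carrier F,
      monoid.mult = (\<lambda>x y. \<lambda>g\<in>carrier G.
         \<Oplus>\<^bsub>F\<^esub>h\<in>carrier G. x h \<otimes>\<^bsub>F\<^esub> y (inv\<^bsub>G\<^esub> h \<otimes>\<^bsub>G\<^esub> g)),
      monoid.one = (\<lambda>g\<in>carrier G. if g = \<one>\<^bsub>G\<^esub> then \<one>\<^bsub>F\<^esub> else \<zero>\<^bsub>F\<^esub>),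
      ring.zero = (\<lambda>g\<in>carrier G. \<zero>\<^bsub>F\<^esub>),
      ring.add = (\<lambda>x y. \<lambda>g\<in>carrier G. x g \<oplus>\<^bsub>F\<^esub> y g)\<rparr>"

definition normalized_units ::
    "('f, 'a) ring_scheme \<Rightarrow> ('g, 'b) monoid_scheme \<Rightarrow> ('g \<Rightarrow> 'f) set" where
  "normalized_units F G =
     {x \<in> carrier (group_algebra F G). (\<Oplus>\<^bsub>F\<^esub>g\<in>carrier G. x g) = \<one>\<^bsub>F\<^esub>}"

definition star :: "('g, 'b) monoid_scheme \<Rightarrow> ('g \<Rightarrow> 'f) \<Rightarrow> ('g \<Rightarrow> 'f)" where
  "star G x = (\<lambda>g\<in>carrier G. x (inv\<^bsub>G\<^esub> g))"

text \<open>For a finite 2-group \<open>G\<close> and a finite field \<open>F\<close> of characteristic 2 every element of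
  \<open>normalized_units F G\<close> is invertible, so the inverse below is the genuine one.\<close>

definition unitary_subgroup ::
    "('f, 'a) ring_scheme \<Rightarrow> ('g, 'b) monoid_scheme \<Rightarrow> ('g \<Rightarrow> 'f) set" where
  "unitary_subgroup F G =
     {x \<in> normalized_units F G. star G x = inv\<^bsub>group_algebra F G\<^esub> x}"

text \<open>The set itself, not the subgroup generated by it.\<close>

definition Omega1 :: "('g, 'b) monoid_scheme \<Rightarrow> 'g set" where
  "Omega1 G = {g \<in> carrier G. g [^]\<^bsub>G\<^esub> (2::nat) = \<one>\<^bsub>G\<^esub>}"

definition group_center :: "('g, 'b) monoid_scheme \<Rightarrow> 'g set" where
  "group_center G = {z \<in> carrier G. \<forall>g\<in>carrier G. z \<otimes>\<^bsub>G\<^esub> g = g \<otimes>\<^bsub>G\<^esub> z}"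

definition central_extension ::
    "('n, 'a) monoid_scheme \<Rightarrow> ('g, 'b) monoid_scheme \<Rightarrow> ('q, 'c) monoid_scheme
      \<Rightarrow> ('n \<Rightarrow> 'g) \<Rightarrow> ('g \<Rightarrow> 'q) \<Rightarrow> bool" where
  "central_extension N G Q \<iota> \<pi> \<longleftrightarrow>
     group N \<and> group G \<and> group Q \<and>
     \<iota> \<in> mon N G \<and> \<pi> \<in> epi G Q \<and>
     \<iota> ` carrier N = kernel G Q \<pi> \<and>
     \<iota> ` carrier N \<subseteq> group_center G"

end

theory Submission
  imports Defs
begin

text \<open>Every element of \<open>V(FG)\<close> is a unit, and the fibres of \<open>x \<mapsto> x x\<^sup>*\<close> on \<open>V(FG)\<close> are the left cosets of \<open>V\<^sub>*(FG)\<close>, so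
  \<open>|V\<^sub>*(FG)| \<cdot> |{x x\<^sup>* : x \<in> V(FG)}| = |V(FG)|\<close>, which is \<open>|F|\<close> to the power \<open>|G| - 1\<close>.
  An element \<open>x x\<^sup>*\<close> is symmetric; since \<open>char F = 2\<close>, its coefficient at \<open>1\<close> is
  \<open>(\<Sum>\<alpha>\<^sub>g)\<^sup>2 = 1\<close> and its coefficients at involutions vanish, because the summands of the
  convolution cancel in pairs. It is therefore determined by one coefficient for each of
  the \<open>(|G| - |\<Omega>\<^sub>1(G)|) / 2\<close> pairs \<open>{g, g\<inverse>}\<close> with \<open>g\<^sup>2 \<noteq> 1\<close>, which bounds the number of
  these elements. All cardinalities are powers of 2, so the resulting lower bound for
  \<open>|V\<^sub>*(FG)|\<close> is a divisibility.\<close>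

section \<open>Finite sums and pairing arguments in characteristic 2\<close>

lemma (in abelian_monoid) finsum_swap:
  assumes "finite A" "finite B" "\<And>i j. i \<in> A \<Longrightarrow> j \<in> B \<Longrightarrow> f i j \<in> carrier G"
  shows "(\<Oplus>i\<in>A. \<Oplus>j\<in>B. f i j) = (\<Oplus>j\<in>B. \<Oplus>i\<in>A. f i j)"
  using assms(1,3)
proof (induction A)
  case empty
  then show ?case by (simp add: finsum_zero)
next
  case (insert a A)
  have "(\<Oplus>i\<in>insert a A. \<Oplus>j\<in>B. f i j) = (\<Oplus>j\<in>B. f a j) \<oplus> (\<Oplus>j\<in>B. \<Oplus>i\<in>A. f i j)"
    using insert by (subst finsum_insert) (auto intro!: finsum_closed)
  also have "\<dots> = (\<Oplus>j\<in>B. f a j \<oplus> (\<Oplus>i\<in>A. f i j))"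
    using insert by (intro finsum_addf [symmetric]) (auto intro!: finsum_closed)
  also have "\<dots> = (\<Oplus>j\<in>B. \<Oplus>i\<in>insert a A. f i j)"
    using insert by (intro finsum_cong') (auto intro!: finsum_closed finsum_insert [symmetric])
  finally show ?case .
qed

lemma (in abelian_monoid) finsum_bij_betw:
  assumes "bij_betw \<sigma> A B" "f \<in> B \<rightarrow> carrier G"
  shows "(\<Oplus>i\<in>A. f (\<sigma> i)) = (\<Oplus>j\<in>B. f j)"
  using assms finsum_reindex [of f \<sigma> A] by (auto simp: bij_betw_def)

text \<open>A fixed-point-free involution cuts the set into two-element orbits; the induction
  removes one orbit at a time.\<close>

lemma even_card_involution:
  assumes "finite A"
    and "\<And>a. a \<in> A \<Longrightarrow> \<sigma> a \<in> A" "\<And>a. a \<in> A \<Longrightarrow> \<sigma> (\<sigma> a) = a" "\<And>a. a \<in> A \<Longrightarrow> \<sigma> a \<noteq> a"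
  shows "even (card A)"
  using assms
proof (induction A rule: finite_psubset_induct)
  case (psubset A)
  show ?case
  proof (cases "A = {}")
    case False
    then obtain a where a: "a \<in> A" by blast
    have sub: "{a, \<sigma> a} \<subseteq> A" and two: "card {a, \<sigma> a} = 2"
      using a psubset.prems(1) not_sym [OF psubset.prems(3) [OF a]] by auto
    have "even (card (A - {a, \<sigma> a}))"
    proof (rule psubset.IH)
      \<comment> \<open>An element sent into the removed pair would lie in it, because
        \<open>\<sigma>\<close> is its own inverse.\<close>
      show "\<sigma> b \<in> A - {a, \<sigma> a}" if "b \<in> A - {a, \<sigma> a}" for b
        using that a psubset.prems(1,2) by (metis Diff_iff insert_iff empty_iff)
    qed (use a psubset.prems in auto)
    then have "even (card (A - {a, \<sigma> a}) + card {a, \<sigma> a})"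
      unfolding two by simp
    then show ?thesis
      using card_Diff_subset [OF _ sub] card_mono [OF psubset.hyps sub] by simp
  qed simp
qed

text \<open>The two summands over each orbit of \<open>\<sigma>\<close> are equal, so they cancel;
  orbits are removed one by one as in the parity argument.\<close>

lemma (in abelian_monoid) finsum_involution_eq_zero:
  assumes "finite A"
    and "\<And>a. a \<in> A \<Longrightarrow> \<sigma> a \<in> A" "\<And>a. a \<in> A \<Longrightarrow> \<sigma> (\<sigma> a) = a" "\<And>a. a \<in> A \<Longrightarrow> \<sigma> a \<noteq> a"
    and "\<And>a. a \<in> A \<Longrightarrow> f a \<in> carrier G" "\<And>a. a \<in> A \<Longrightarrow> f (\<sigma> a) = f a"
    and "\<And>x. x \<in> carrier G \<Longrightarrow> x \<oplus> x = \<zero>"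
  shows "finsum G f A = \<zero>"
  using assms(1-6)
proof (induction A rule: finite_psubset_induct)
  case (psubset A)
  show ?case
  proof (cases "A = {}")
    case False
    then obtain a where a: "a \<in> A" by blast
    define B where "B = A - {a, \<sigma> a}"
    have A: "A = insert a (insert (\<sigma> a) B)"
      using a psubset.prems(1) by (auto simp: B_def)
    have "finsum G f B = \<zero>"
    proof (rule psubset.IH)
      show "B \<subset> A" using a by (auto simp: B_def)
      show "\<sigma> b \<in> B" if "b \<in> B" for b
        using that a psubset.prems(1,2) unfolding B_def by (metis Diff_iff insert_iff empty_iff)
    qed (use psubset.prems in \<open>auto simp: B_def\<close>)
    moreover have "finsum G f A = f a \<oplus> (f (\<sigma> a) \<oplus> finsum G f B)"
      unfolding A using psubset.hyps psubset.prems a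
      by (subst finsum_insert; (subst finsum_insert)?) (auto simp: B_def Pi_def dest: psubset.prems(3)[THEN not_sym])
    ultimately show ?thesis
      using a psubset.prems assms(7) by simp
  qed simp
qed

text \<open>Additivity of the Frobenius map: squaring a sum creates every mixed product
  twice.\<close>

lemma (in cring) finsum_square_char_2:
  assumes two: "\<And>x. x \<in> carrier R \<Longrightarrow> x \<oplus> x = \<zero>"
    and "finite A" "f \<in> A \<rightarrow> carrier R"
  shows "(\<Oplus>a\<in>A. f a \<otimes> f a) = (\<Oplus>a\<in>A. f a) \<otimes> (\<Oplus>a\<in>A. f a)"
  using assms(2,3)
proof (induction A)
  case (insert a A)
  define s where "s = (\<Oplus>a\<in>A. f a)"
  have f: "f a \<in> carrier R" "s \<in> carrier R" "f \<in> A \<rightarrow> carrier R"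
    using insert by (auto simp: s_def)
  have "(f a \<oplus> s) \<otimes> (f a \<oplus> s) = f a \<otimes> f a \<oplus> s \<otimes> s \<oplus> (f a \<otimes> s \<oplus> f a \<otimes> s)"
    using f(1,2) by algebra
  then have "(f a \<oplus> s) \<otimes> (f a \<oplus> s) = f a \<otimes> f a \<oplus> s \<otimes> s"
    using f by (simp add: two)
  then show ?case
    using insert f by (subst (1 2 3) finsum_insert) (auto simp: s_def)
qed simp

lemma (in cring) add_self_char_2:
  assumes "ring_characteristic R = 2" "x \<in> carrier R"
  shows "x \<oplus> x = \<zero>"
proof -
  let ?P = "\<lambda>n::nat. 0 < n \<and> [n] \<cdot> \<one> = \<zero>"
  \<comment> \<open>The value 2 differs from the default 0, so the \<open>LEAST\<close> branch of
    the definition applies and its property holds at 2.\<close>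
  have ex: "\<exists>n. ?P n" and "Least ?P = 2"
    using assms(1) unfolding ring_characteristic_def by (auto split: if_splits)
  then have "[(2::nat)] \<cdot> \<one> = \<zero>"
    using LeastI_ex [OF ex] by simp
  then have "\<one> \<oplus> \<one> = \<zero>"
    by (simp add: numeral_2_eq_2)
  moreover have "x \<oplus> x = (\<one> \<oplus> \<one>) \<otimes> x"
    using assms(2) by (simp add: l_distr)
  ultimately show ?thesis
    using assms(2) by simp
qed

section \<open>Groups of exponent 2 and fixed points of actions of \<open>p\<close>-groups\<close>

text \<open>Serves for the additive group of \<open>F\<close>. A prime divisor \<open>p\<close> of
  the order yields, by Sylow, a subgroup of order \<open>p\<close>; a nontrivial element of it has
  order dividing both \<open>p\<close> and 2.\<close>

lemma (in group) order_power_of_2: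
  assumes "finite (carrier G)" and sq: "\<And>x. x \<in> carrier G \<Longrightarrow> x \<otimes> x = \<one>"
  shows "\<exists>k. order G = 2 ^ k"
proof -
  have "p = 2" if p: "Factorial_Ring.prime p" "p dvd order G" for p :: nat
  proof -
    obtain m where "order G = p ^ 1 * m"
      using p(2) by auto
    then obtain H where H: "subgroup H G" "card H = p"
      using sylow_thm [of p G 1 m] p(1) assms(1) is_group by auto
    have "H \<noteq> {\<one>}"
      using H(2) p(1) by auto
    then obtain h where h: "h \<in> H" "h \<noteq> \<one>"
      using subgroup.one_closed [OF H(1)] by blast
    have hG: "h \<in> carrier G"
      using h(1) subgroup.mem_carrier [OF H(1)] by blast
    interpret H: group "G\<lparr>carrier := H\<rparr>"
      using subgroup_imp_group [OF H(1)] .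
    have "h [^]\<^bsub>G\<lparr>carrier := H\<rparr>\<^esub> order (G\<lparr>carrier := H\<rparr>) = \<one>"
      using H.pow_order_eq_1 h(1) by simp
    then have "h [^] p = \<one>"
      using H(2) by (simp add: order_def flip: nat_pow_consistent)
    moreover have "h [^] (2::nat) = \<one>"
      using sq hG by (simp add: numeral_2_eq_2)
    ultimately have "ord h dvd p" "ord h dvd 2"
      using hG by (auto simp: pow_eq_id)
    moreover have "ord h \<noteq> 1"
      using h(2) hG ord_eq_1 by blast
    ultimately show ?thesis
      using p(1) two_is_prime_nat by (metis prime_nat_iff)
  qed
  moreover obtain a m where m: "\<not> 2 dvd m" "order G = m * 2 ^ a"
    using prime_power_canonical [OF two_is_prime_nat, of "order G"]
      order_gt_0_iff_finite assms(1) by auto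
  \<comment> \<open>A prime factor of the odd cofactor \<open>m\<close> would divide the order and
    hence be 2.\<close>
  ultimately have "m = 1"
    by (metis dvd_mult2 prime_factor_nat)
  then show ?thesis
    using m(2) by auto
qed

text \<open>The target \<open>BijGroup E\<close> consists of functions extensional on
  \<open>E\<close>, hence the restriction. Bijectivity comes from \<open>\<phi> (inv g)\<close>
  inverting \<open>\<phi> g\<close>.\<close>

lemma group_actionI:
  fixes G (structure)
  assumes "group G"
    and closed: "\<And>g x. g \<in> carrier G \<Longrightarrow> x \<in> E \<Longrightarrow> \<phi> g x \<in> E"
    and one: "\<And>x. x \<in> E \<Longrightarrow> \<phi> \<one> x = x"
    and mult: "\<And>g h x. g \<in> carrier G \<Longrightarrow> h \<in> carrier G \<Longrightarrow> x \<in> E \<Longrightarrow> \<phi> (g \<otimes> h) x = \<phi> g (\<phi> h x)"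
  shows "group_action G E (\<lambda>g. \<lambda>x\<in>E. \<phi> g x)"
proof -
  interpret group G by fact
  have Bij: "(\<lambda>x\<in>E. \<phi> g x) \<in> Bij E" if g: "g \<in> carrier G" for g
  proof -
    have "bij_betw (\<phi> g) E E"
    proof (rule bij_betwI [where g = "\<phi> (inv g)"])
      show "\<phi> (inv g) (\<phi> g x) = x" if "x \<in> E" for x
        using that g mult [of "inv g" g x] one by simp
      show "\<phi> g (\<phi> (inv g) x) = x" if "x \<in> E" for x
        using that g mult [of g "inv g" x] one by simp
    qed (use closed g in auto)
    then show ?thesis
      by (simp add: Bij_def bij_betw_def cong: image_cong inj_on_cong)
  qed
  have "(\<lambda>g. \<lambda>x\<in>E. \<phi> g x) \<in> hom G (BijGroup E)"
  proof (rule homI)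
    fix g h assume gh: "g \<in> carrier G" "h \<in> carrier G"
    show "(\<lambda>x\<in>E. \<phi> (g \<otimes> h) x) = (\<lambda>x\<in>E. \<phi> g x) \<otimes>\<^bsub>BijGroup E\<^esub> (\<lambda>x\<in>E. \<phi> h x)"
      using Bij gh closed by (auto simp: BijGroup_def compose_def mult)
  qed (simp add: BijGroup_def Bij)
  then show ?thesis
    unfolding group_action_def group_hom_def group_hom_axioms_def
    using group_BijGroup is_group by blast
qed

text \<open>An orbit of moved points has a size dividing \<open>p ^ k\<close> and different from 1,
  hence divisible by \<open>p\<close>; every other orbit is a single fixed point.\<close>

lemma (in group_action) prime_dvd_card_non_fixed_points:
  assumes "Factorial_Ring.prime p" "order G = p ^ k" "finite E"
  shows "p dvd card {x \<in> E. \<exists>g\<in>carrier G. \<phi> g x \<noteq> x}"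
proof -
  let ?N = "{x \<in> E. \<exists>g\<in>carrier G. \<phi> g x \<noteq> x}"
  \<comment> \<open>Written as a sum of an indicator function, the count can be split over the
    orbits by \<open>disjoint_sum\<close>.\<close>
  have "card ?N = (\<Sum>x\<in>E. if x \<in> ?N then 1 else 0)"
    using assms(3) by (subst sum.If_cases) (simp_all add: Int_absorb1)
  also have "\<dots> = (\<Sum>orb\<in>orbits G E \<phi>. \<Sum>x\<in>orb. if x \<in> ?N then 1 else 0)"
    using disjoint_sum [OF assms(3)] ..
  also have "p dvd \<dots>"
  proof (rule dvd_sum)
    fix orb assume "orb \<in> orbits G E \<phi>"
    then obtain x where x: "x \<in> E" "orb = orbit G \<phi> x"
      by (auto simp: orbits_def)
    have sub: "orb \<subseteq> E"
      using x element_image by (auto simp: orbit_def)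
    then have fin: "finite orb"
      using assms(3) finite_subset by blast
    show "p dvd (\<Sum>x\<in>orb. if x \<in> ?N then 1 else 0)"
    proof (cases "orb \<subseteq> ?N")
      case True
      then have "(\<Sum>x\<in>orb. if x \<in> ?N then 1 else 0) = card orb"
        using fin by (simp add: sum.If_cases Int_absorb2)
      moreover have "card orb dvd p ^ k"
        using orbit_stabilizer_theorem [OF x(1)] x(2) assms(2) by (metis dvd_triv_left)
      moreover have "card orb \<noteq> 1"
      proof
        assume "card orb = 1"
        moreover have "x \<in> orb"
          using orbit_refl x by simp
        ultimately have "orb = {x}"
          by (auto simp: card_1_singleton_iff)
        then have "\<forall>g\<in>carrier G. \<phi> g x = x"
          using x(2) by (auto simp: orbit_def)
        then show False
          using True \<open>x \<in> orb\<close> by auto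
      qed
      ultimately show ?thesis
        using assms(1) by (metis divides_primepow_nat dvd_power not_gr_zero power_0)
    next
      case False
      then obtain y where y: "y \<in> E" "y \<in> orb" "\<And>g. g \<in> carrier G \<Longrightarrow> \<phi> g y = y"
        using sub by blast
      \<comment> \<open>An orbit containing the fixed point \<open>y\<close> is the orbit of
        \<open>y\<close>, that is \<open>{y}\<close>, where the indicator vanishes.\<close>
      have "z = y" if "z \<in> orb" for z
      proof -
        have "z \<in> orbit G \<phi> y"
          using orbit_trans [of y x z] orbit_sym [of x y] that x y(1,2) sub by blast
        then show ?thesis
          using y(3) by (auto simp: orbit_def)
      qed
      then have "orb = {y}"
        using y(2) by blast
      then show ?thesis
        using y by simp
    qed
  qed
  finally show ?thesis .
qed

section \<open>The group algebra: convolution, augmentation and \<open>star\<close>\<close>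

locale finite_group_algebra = F: cring F + G: group G
  for F :: "('f, 'a) ring_scheme" and G :: "('g, 'b) monoid_scheme" +
  assumes finite_G: "finite (carrier G)"
begin

abbreviation A where "A \<equiv> group_algebra F G"
abbreviation V where "V \<equiv> normalized_units F G"
abbreviation augmentation where "augmentation x \<equiv> \<Oplus>\<^bsub>F\<^esub>g\<in>carrier G. x g"

lemma carrier_algebra: "carrier A = carrier G \<rightarrow>\<^sub>E carrier F"
  by (simp add: group_algebra_def)

lemma coeff_closed: "x \<in> carrier A \<Longrightarrow> g \<in> carrier G \<Longrightarrow> x g \<in> carrier F"
  by (auto simp: carrier_algebra)

lemma algebra_eqI:
  assumes "x \<in> carrier A" "y \<in> carrier A" "\<And>g. g \<in> carrier G \<Longrightarrow> x g = y g"
  shows "x = y"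
  using assms by (auto simp: carrier_algebra intro: PiE_ext)

lemma mult_coeff:
  "g \<in> carrier G \<Longrightarrow>
     (x \<otimes>\<^bsub>A\<^esub> y) g = (\<Oplus>\<^bsub>F\<^esub>h\<in>carrier G. x h \<otimes>\<^bsub>F\<^esub> y (inv\<^bsub>G\<^esub> h \<otimes>\<^bsub>G\<^esub> g))"
  by (simp add: group_algebra_def)

lemma one_coeff: "g \<in> carrier G \<Longrightarrow> \<one>\<^bsub>A\<^esub> g = (if g = \<one>\<^bsub>G\<^esub> then \<one>\<^bsub>F\<^esub> else \<zero>\<^bsub>F\<^esub>)"
  by (simp add: group_algebra_def)

lemma mult_closed: "x \<in> carrier A \<Longrightarrow> y \<in> carrier A \<Longrightarrow> x \<otimes>\<^bsub>A\<^esub> y \<in> carrier A"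
  by (auto simp: group_algebra_def intro!: F.finsum_closed)

lemma one_closed: "\<one>\<^bsub>A\<^esub> \<in> carrier A"
  by (auto simp: group_algebra_def)

lemma bij_left_translation: "a \<in> carrier G \<Longrightarrow> bij_betw (\<lambda>h. a \<otimes>\<^bsub>G\<^esub> h) (carrier G) (carrier G)"
  by (rule bij_betwI [where g = "\<lambda>h. inv\<^bsub>G\<^esub> a \<otimes>\<^bsub>G\<^esub> h"]) (auto simp flip: G.m_assoc)

lemma finsum_single:
  assumes "a \<in> carrier G" "c \<in> carrier F"
    and "\<And>g. g \<in> carrier G \<Longrightarrow> f g = (if g = a then c else \<zero>\<^bsub>F\<^esub>)"
  shows "(\<Oplus>\<^bsub>F\<^esub>g\<in>carrier G. f g) = c"
proof -
  have "(\<Oplus>\<^bsub>F\<^esub>g\<in>carrier G. f g) = (\<Oplus>\<^bsub>F\<^esub>g\<in>carrier G. if a = g then (\<lambda>_. c) g else \<zero>\<^bsub>F\<^esub>)"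
    using assms by (intro F.finsum_cong') auto
  also have "\<dots> = c"
    using assms finite_G by (subst F.finsum_singleton) auto
  finally show ?thesis .
qed

text \<open>Both sides expand to double sums over \<open>h\<close> and \<open>k\<close>; they agree
  after exchanging the sums and replacing \<open>h\<close> by \<open>k\<close> times
  \<open>h\<close>.\<close>

lemma mult_assoc:
  assumes x: "x \<in> carrier A" and y: "y \<in> carrier A" and z: "z \<in> carrier A"
  shows "(x \<otimes>\<^bsub>A\<^esub> y) \<otimes>\<^bsub>A\<^esub> z = x \<otimes>\<^bsub>A\<^esub> (y \<otimes>\<^bsub>A\<^esub> z)"
proof (rule algebra_eqI)
  fix g assume g: "g \<in> carrier G"
  note c = coeff_closed [OF x] coeff_closed [OF y] coeff_closed [OF z]
  have "((x \<otimes>\<^bsub>A\<^esub> y) \<otimes>\<^bsub>A\<^esub> z) g =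
      (\<Oplus>\<^bsub>F\<^esub>h\<in>carrier G. \<Oplus>\<^bsub>F\<^esub>k\<in>carrier G.
         x k \<otimes>\<^bsub>F\<^esub> (y (inv\<^bsub>G\<^esub> k \<otimes>\<^bsub>G\<^esub> h) \<otimes>\<^bsub>F\<^esub> z (inv\<^bsub>G\<^esub> h \<otimes>\<^bsub>G\<^esub> g)))"
    unfolding mult_coeff [OF g]
    by (intro F.finsum_cong') (auto simp: mult_coeff F.finsum_ldistr finite_G c g F.m_assoc
        intro!: F.finsum_cong' F.finsum_closed)
  also have "\<dots> = (\<Oplus>\<^bsub>F\<^esub>k\<in>carrier G. \<Oplus>\<^bsub>F\<^esub>h\<in>carrier G.
         x k \<otimes>\<^bsub>F\<^esub> (y (inv\<^bsub>G\<^esub> k \<otimes>\<^bsub>G\<^esub> h) \<otimes>\<^bsub>F\<^esub> z (inv\<^bsub>G\<^esub> h \<otimes>\<^bsub>G\<^esub> g)))"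
    by (intro F.finsum_swap finite_G) (auto simp: c g)
  also have "\<dots> = (\<Oplus>\<^bsub>F\<^esub>k\<in>carrier G. \<Oplus>\<^bsub>F\<^esub>h\<in>carrier G.
         x k \<otimes>\<^bsub>F\<^esub> (y h \<otimes>\<^bsub>F\<^esub> z (inv\<^bsub>G\<^esub> h \<otimes>\<^bsub>G\<^esub> (inv\<^bsub>G\<^esub> k \<otimes>\<^bsub>G\<^esub> g))))"
  proof (rule F.finsum_cong')
    fix k assume k: "k \<in> carrier G"
    show "(\<Oplus>\<^bsub>F\<^esub>h\<in>carrier G.
         x k \<otimes>\<^bsub>F\<^esub> (y (inv\<^bsub>G\<^esub> k \<otimes>\<^bsub>G\<^esub> h) \<otimes>\<^bsub>F\<^esub> z (inv\<^bsub>G\<^esub> h \<otimes>\<^bsub>G\<^esub> g))) =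
      (\<Oplus>\<^bsub>F\<^esub>h\<in>carrier G.
         x k \<otimes>\<^bsub>F\<^esub> (y h \<otimes>\<^bsub>F\<^esub> z (inv\<^bsub>G\<^esub> h \<otimes>\<^bsub>G\<^esub> (inv\<^bsub>G\<^esub> k \<otimes>\<^bsub>G\<^esub> g))))"
      using k g c
      by (subst F.finsum_bij_betw [OF bij_left_translation [OF k], symmetric])
        (auto simp: G.inv_mult_group G.m_assoc [symmetric] intro!: F.finsum_cong')
  qed (auto simp: c g intro!: F.finsum_closed)
  also have "\<dots> = (x \<otimes>\<^bsub>A\<^esub> (y \<otimes>\<^bsub>A\<^esub> z)) g"
    unfolding mult_coeff [OF g]
    by (intro F.finsum_cong') (auto simp: mult_coeff F.finsum_rdistr finite_G c g
        intro!: F.finsum_cong' F.finsum_closed)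
  finally show "((x \<otimes>\<^bsub>A\<^esub> y) \<otimes>\<^bsub>A\<^esub> z) g = (x \<otimes>\<^bsub>A\<^esub> (y \<otimes>\<^bsub>A\<^esub> z)) g" .
qed (intro mult_closed x y z)+

lemma one_mult:
  assumes x: "x \<in> carrier A"
  shows "\<one>\<^bsub>A\<^esub> \<otimes>\<^bsub>A\<^esub> x = x"
proof (rule algebra_eqI)
  fix g assume g: "g \<in> carrier G"
  show "(\<one>\<^bsub>A\<^esub> \<otimes>\<^bsub>A\<^esub> x) g = x g"
    unfolding mult_coeff [OF g]
    by (rule finsum_single [of "\<one>\<^bsub>G\<^esub>"]) (auto simp: one_coeff coeff_closed [OF x] g)
qed (intro mult_closed x one_closed)+

lemma mult_one:
  assumes x: "x \<in> carrier A"
  shows "x \<otimes>\<^bsub>A\<^esub> \<one>\<^bsub>A\<^esub> = x"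
proof (rule algebra_eqI)
  fix g assume g: "g \<in> carrier G"
  have "inv\<^bsub>G\<^esub> h \<otimes>\<^bsub>G\<^esub> g = \<one>\<^bsub>G\<^esub> \<longleftrightarrow> h = g" if "h \<in> carrier G" for h
    using that g by (metis G.inv_closed G.inv_equality G.inv_inv G.l_inv)
  then show "(x \<otimes>\<^bsub>A\<^esub> \<one>\<^bsub>A\<^esub>) g = x g"
    unfolding mult_coeff [OF g]
    by (intro finsum_single [of g]) (auto simp: one_coeff coeff_closed [OF x] g)
qed (intro mult_closed x one_closed)+

sublocale A: monoid A
  by (rule monoidI) (auto intro: mult_closed one_closed mult_assoc one_mult mult_one)

lemma augmentation_closed: "x \<in> carrier A \<Longrightarrow> augmentation x \<in> carrier F"
  by (auto intro!: F.finsum_closed coeff_closed)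

lemma augmentation_one: "augmentation \<one>\<^bsub>A\<^esub> = \<one>\<^bsub>F\<^esub>"
  by (rule finsum_single [of "\<one>\<^bsub>G\<^esub>"]) (auto simp: one_coeff)

text \<open>Once the sums are exchanged, the inner one runs over a left translate of
  \<open>y\<close>, and translation permutes \<open>G\<close>.\<close>

lemma augmentation_mult:
  assumes x: "x \<in> carrier A" and y: "y \<in> carrier A"
  shows "augmentation (x \<otimes>\<^bsub>A\<^esub> y) = augmentation x \<otimes>\<^bsub>F\<^esub> augmentation y"
proof -
  note c = coeff_closed [OF x] coeff_closed [OF y]
  have "augmentation (x \<otimes>\<^bsub>A\<^esub> y) =
      (\<Oplus>\<^bsub>F\<^esub>g\<in>carrier G. \<Oplus>\<^bsub>F\<^esub>h\<in>carrier G. x h \<otimes>\<^bsub>F\<^esub> y (inv\<^bsub>G\<^esub> h \<otimes>\<^bsub>G\<^esub> g))"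
    by (intro F.finsum_cong') (auto simp: mult_coeff c intro!: F.finsum_closed)
  also have "\<dots> = (\<Oplus>\<^bsub>F\<^esub>h\<in>carrier G. \<Oplus>\<^bsub>F\<^esub>g\<in>carrier G. x h \<otimes>\<^bsub>F\<^esub> y (inv\<^bsub>G\<^esub> h \<otimes>\<^bsub>G\<^esub> g))"
    by (intro F.finsum_swap finite_G) (auto simp: c)
  also have "\<dots> = (\<Oplus>\<^bsub>F\<^esub>h\<in>carrier G. x h \<otimes>\<^bsub>F\<^esub> augmentation y)"
  proof (rule F.finsum_cong')
    fix h assume h: "h \<in> carrier G"
    have "(\<Oplus>\<^bsub>F\<^esub>g\<in>carrier G. x h \<otimes>\<^bsub>F\<^esub> y (inv\<^bsub>G\<^esub> h \<otimes>\<^bsub>G\<^esub> g)) =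
        (\<Oplus>\<^bsub>F\<^esub>g\<in>carrier G. x h \<otimes>\<^bsub>F\<^esub> y g)"
      using h c by (intro F.finsum_bij_betw bij_left_translation) auto
    then show "(\<Oplus>\<^bsub>F\<^esub>g\<in>carrier G. x h \<otimes>\<^bsub>F\<^esub> y (inv\<^bsub>G\<^esub> h \<otimes>\<^bsub>G\<^esub> g)) =
        x h \<otimes>\<^bsub>F\<^esub> augmentation y"
      using h c finite_G by (subst F.finsum_rdistr) auto
  qed (auto simp: c intro!: F.finsum_closed)
  also have "\<dots> = augmentation x \<otimes>\<^bsub>F\<^esub> augmentation y"
    using c finite_G by (subst F.finsum_ldistr) (auto intro!: F.finsum_closed)
  finally show ?thesis .
qed

lemma star_closed: "x \<in> carrier A \<Longrightarrow> star G x \<in> carrier A"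
  by (auto simp: star_def carrier_algebra)

lemma star_coeff: "g \<in> carrier G \<Longrightarrow> star G x g = x (inv\<^bsub>G\<^esub> g)"
  by (simp add: star_def)

lemma star_star: "x \<in> carrier A \<Longrightarrow> star G (star G x) = x"
  by (rule algebra_eqI) (auto simp: star_coeff intro!: star_closed)

lemma star_one: "star G \<one>\<^bsub>A\<^esub> = \<one>\<^bsub>A\<^esub>"
  by (rule algebra_eqI) (auto simp: star_coeff one_coeff intro!: star_closed)

text \<open>Inversion reverses products in \<open>G\<close>, and commutativity of \<open>F\<close>
  lets the coefficients change places.\<close>

lemma star_mult:
  assumes x: "x \<in> carrier A" and y: "y \<in> carrier A"
  shows "star G (x \<otimes>\<^bsub>A\<^esub> y) = star G y \<otimes>\<^bsub>A\<^esub> star G x"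
proof (rule algebra_eqI)
  fix g assume g: "g \<in> carrier G"
  note c = coeff_closed [OF x] coeff_closed [OF y]
  have "(star G y \<otimes>\<^bsub>A\<^esub> star G x) g =
      (\<Oplus>\<^bsub>F\<^esub>h\<in>carrier G. y (inv\<^bsub>G\<^esub> h) \<otimes>\<^bsub>F\<^esub> x (inv\<^bsub>G\<^esub> g \<otimes>\<^bsub>G\<^esub> h))"
    unfolding mult_coeff [OF g]
    using g c by (intro F.finsum_cong') (auto simp: star_coeff G.inv_mult_group)
  \<comment> \<open>Replacing \<open>h\<close> by \<open>g\<close> times \<open>h\<close> turns the
    second factor into \<open>x h\<close>.\<close>
  also have "\<dots> = (\<Oplus>\<^bsub>F\<^esub>h\<in>carrier G. x h \<otimes>\<^bsub>F\<^esub> y (inv\<^bsub>G\<^esub> h \<otimes>\<^bsub>G\<^esub> inv\<^bsub>G\<^esub> g))"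
    using g c
    by (subst F.finsum_bij_betw [OF bij_left_translation [OF g], symmetric])
      (auto simp: G.inv_mult_group F.m_comm G.m_assoc [symmetric] intro!: F.finsum_cong')
  also have "\<dots> = star G (x \<otimes>\<^bsub>A\<^esub> y) g"
    using g by (simp add: star_coeff mult_coeff)
  finally show "star G (x \<otimes>\<^bsub>A\<^esub> y) g = (star G y \<otimes>\<^bsub>A\<^esub> star G x) g" ..
qed (intro star_closed mult_closed x y)+

lemma normalized_unitsD:
  assumes "x \<in> V"
  shows "x \<in> carrier A" "augmentation x = \<one>\<^bsub>F\<^esub>"
  using assms by (auto simp: normalized_units_def)

lemma normalized_unitsI: "x \<in> carrier A \<Longrightarrow> augmentation x = \<one>\<^bsub>F\<^esub> \<Longrightarrow> x \<in> V"
  by (auto simp: normalized_units_def)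

text \<open>The coefficients away from the identity of \<open>G\<close> are free, and the remaining
  one is forced by augmentation 1.\<close>

lemma card_normalized_units: "card V = card (carrier F) ^ (order G - 1)"
proof -
  let ?H = "carrier G - {\<one>\<^bsub>G\<^esub>}"
  have split: "augmentation x = x \<one>\<^bsub>G\<^esub> \<oplus>\<^bsub>F\<^esub> (\<Oplus>\<^bsub>F\<^esub>g\<in>?H. x g)"
    if "x \<in> carrier G \<rightarrow> carrier F" for x
    using that finite_G F.finsum_insert [of ?H "\<one>\<^bsub>G\<^esub>" x] by (auto simp: insert_absorb)
  \<comment> \<open>\<open>ext\<close> inverts the restriction to \<open>?H\<close>: its value at
    the identity is what brings the augmentation to 1.\<close>
  define ext where
    "ext z = (\<lambda>g\<in>carrier G. if g = \<one>\<^bsub>G\<^esub> then \<one>\<^bsub>F\<^esub> \<ominus>\<^bsub>F\<^esub> (\<Oplus>\<^bsub>F\<^esub>g\<in>?H. z g) else z g)" for z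
  have "bij_betw (\<lambda>x. restrict x ?H) V (?H \<rightarrow>\<^sub>E carrier F)"
  proof (rule bij_betwI [where g = ext])
    show "(\<lambda>x. restrict x ?H) \<in> V \<rightarrow> (?H \<rightarrow>\<^sub>E carrier F)"
      by (simp add: Pi_def restrict_PiE_iff coeff_closed normalized_unitsD(1) del: restrict_apply)
    have sum_ext: "(\<Oplus>\<^bsub>F\<^esub>g\<in>?H. ext z g) = (\<Oplus>\<^bsub>F\<^esub>g\<in>?H. z g)" if "z \<in> ?H \<rightarrow>\<^sub>E carrier F" for z
      using that by (intro F.finsum_cong') (auto simp: ext_def)
    show "ext \<in> (?H \<rightarrow>\<^sub>E carrier F) \<rightarrow> V"
    proof
      fix z assume z: "z \<in> ?H \<rightarrow>\<^sub>E carrier F"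
      have s: "(\<Oplus>\<^bsub>F\<^esub>g\<in>?H. z g) \<in> carrier F"
        using z by (intro F.finsum_closed) auto
      have A: "ext z \<in> carrier A"
        unfolding carrier_algebra
      proof (rule PiE_I)
        fix g assume g: "g \<in> carrier G"
        have "\<one>\<^bsub>F\<^esub> \<ominus>\<^bsub>F\<^esub> (\<Oplus>\<^bsub>F\<^esub>g\<in>?H. z g) \<in> carrier F"
          using s by (intro F.minus_closed F.one_closed)
        then show "ext z g \<in> carrier F"
          using g PiE_mem [OF z, of g] unfolding ext_def by simp
      qed (simp add: ext_def)
      have "augmentation (ext z) = \<one>\<^bsub>F\<^esub> \<ominus>\<^bsub>F\<^esub> (\<Oplus>\<^bsub>F\<^esub>g\<in>?H. z g) \<oplus>\<^bsub>F\<^esub> (\<Oplus>\<^bsub>F\<^esub>g\<in>?H. z g)"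
      proof -
        have "augmentation (ext z) = ext z \<one>\<^bsub>G\<^esub> \<oplus>\<^bsub>F\<^esub> (\<Oplus>\<^bsub>F\<^esub>g\<in>?H. z g)"
          using A sum_ext [OF z] by (subst split) (auto simp: coeff_closed)
        also have "ext z \<one>\<^bsub>G\<^esub> = \<one>\<^bsub>F\<^esub> \<ominus>\<^bsub>F\<^esub> (\<Oplus>\<^bsub>F\<^esub>g\<in>?H. z g)"
          by (simp add: ext_def)
        finally show ?thesis .
      qed
      also have "\<dots> = \<one>\<^bsub>F\<^esub>"
        using s by (simp add: F.minus_eq F.a_assoc F.l_neg)
      finally show "ext z \<in> V"
        using A by (rule normalized_unitsI [rotated])
    qed
    show "ext (restrict x ?H) = x" if "x \<in> V" for x
    proof -
      note x = normalized_unitsD [OF that]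
      have s: "(\<Oplus>\<^bsub>F\<^esub>g\<in>?H. x g) \<in> carrier F"
        using x(1) by (intro F.finsum_closed) (auto simp: carrier_algebra)
      have "\<one>\<^bsub>F\<^esub> \<ominus>\<^bsub>F\<^esub> (\<Oplus>\<^bsub>F\<^esub>g\<in>?H. x g) = x \<one>\<^bsub>G\<^esub>"
      proof -
        have "\<one>\<^bsub>F\<^esub> = x \<one>\<^bsub>G\<^esub> \<oplus>\<^bsub>F\<^esub> (\<Oplus>\<^bsub>F\<^esub>g\<in>?H. x g)"
          using split [of x] x by (simp add: Pi_def coeff_closed)
        then show ?thesis
          using s coeff_closed [OF x(1) G.one_closed] by (simp add: F.minus_eq F.a_assoc F.r_neg)
      qed
      moreover have "finsum F (restrict x ?H) ?H = finsum F x ?H"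
        using x(1) by (intro F.finsum_cong') (auto simp: carrier_algebra)
      ultimately have "ext (restrict x ?H) g = x g" if "g \<in> carrier G" for g
        using that by (simp add: ext_def)
      then show ?thesis
        using x(1) by (intro extensionalityI [of _ "carrier G"]) (simp_all add: carrier_algebra PiE_iff ext_def)
    qed
    show "restrict (ext z) ?H = z" if "z \<in> ?H \<rightarrow>\<^sub>E carrier F" for z
      using that by (intro extensionalityI [of _ ?H]) (simp_all add: ext_def PiE_iff del: restrict_restrict)
  qed
  then have "card V = card (?H \<rightarrow>\<^sub>E carrier F)"
    by (rule bij_betw_same_card)
  then show ?thesis
    using finite_G by (simp add: card_funcsetE order_def)
qed

end

section \<open>Invertibility of the normalized units\<close>

locale finite_group_algebra_char_2 = finite_group_algebra F G
  for F :: "('f, 'a) ring_scheme" and G :: "('g, 'b) monoid_scheme" +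
  assumes finite_F: "finite (carrier F)"
    and char_2: "x \<in> carrier F \<Longrightarrow> x \<oplus>\<^bsub>F\<^esub> x = \<zero>\<^bsub>F\<^esub>"
    and order_G: "\<exists>k. order G = 2 ^ k"
begin

lemma finite_algebra: "finite (carrier A)"
  using finite_F finite_G by (simp add: carrier_algebra finite_PiE)

lemma zero_coeff: "g \<in> carrier G \<Longrightarrow> \<zero>\<^bsub>A\<^esub> g = \<zero>\<^bsub>F\<^esub>"
  by (simp add: group_algebra_def)

lemma add_coeff: "g \<in> carrier G \<Longrightarrow> (x \<oplus>\<^bsub>A\<^esub> y) g = x g \<oplus>\<^bsub>F\<^esub> y g"
  by (simp add: group_algebra_def)

lemma zero_closed: "\<zero>\<^bsub>A\<^esub> \<in> carrier A"
  by (auto simp: group_algebra_def)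

lemma add_closed: "x \<in> carrier A \<Longrightarrow> y \<in> carrier A \<Longrightarrow> x \<oplus>\<^bsub>A\<^esub> y \<in> carrier A"
  by (auto simp: group_algebra_def)

lemma mult_add:
  assumes x: "x \<in> carrier A" and y: "y \<in> carrier A" and z: "z \<in> carrier A"
  shows "x \<otimes>\<^bsub>A\<^esub> (y \<oplus>\<^bsub>A\<^esub> z) = (x \<otimes>\<^bsub>A\<^esub> y) \<oplus>\<^bsub>A\<^esub> (x \<otimes>\<^bsub>A\<^esub> z)"
proof (rule algebra_eqI)
  fix g assume g: "g \<in> carrier G"
  note c = coeff_closed [OF x] coeff_closed [OF y] coeff_closed [OF z]
  have "(x \<otimes>\<^bsub>A\<^esub> (y \<oplus>\<^bsub>A\<^esub> z)) g =
      (\<Oplus>\<^bsub>F\<^esub>h\<in>carrier G. x h \<otimes>\<^bsub>F\<^esub> y (inv\<^bsub>G\<^esub> h \<otimes>\<^bsub>G\<^esub> g) \<oplus>\<^bsub>F\<^esub>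
         x h \<otimes>\<^bsub>F\<^esub> z (inv\<^bsub>G\<^esub> h \<otimes>\<^bsub>G\<^esub> g))"
    unfolding mult_coeff [OF g]
    using g c by (intro F.finsum_cong') (auto simp: add_coeff F.r_distr)
  also have "\<dots> = (x \<otimes>\<^bsub>A\<^esub> y) g \<oplus>\<^bsub>F\<^esub> (x \<otimes>\<^bsub>A\<^esub> z) g"
    unfolding mult_coeff [OF g] using g c by (intro F.finsum_addf) auto
  finally show "(x \<otimes>\<^bsub>A\<^esub> (y \<oplus>\<^bsub>A\<^esub> z)) g = ((x \<otimes>\<^bsub>A\<^esub> y) \<oplus>\<^bsub>A\<^esub> (x \<otimes>\<^bsub>A\<^esub> z)) g"
    using g by (simp add: add_coeff)
qed (intro mult_closed add_closed x y z)+

text \<open>Every element is its own negative, so a sum plays the part of a difference in the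
  cancellation arguments below.\<close>

lemma add_eq_zero_iff:
  assumes x: "x \<in> carrier A" and y: "y \<in> carrier A"
  shows "x \<oplus>\<^bsub>A\<^esub> y = \<zero>\<^bsub>A\<^esub> \<longleftrightarrow> x = y"
proof
  assume sum: "x \<oplus>\<^bsub>A\<^esub> y = \<zero>\<^bsub>A\<^esub>"
  show "x = y"
  proof (rule algebra_eqI [OF x y])
    fix g assume g: "g \<in> carrier G"
    have "x g \<oplus>\<^bsub>F\<^esub> y g = y g \<oplus>\<^bsub>F\<^esub> y g"
      using g char_2 [OF coeff_closed [OF y g]] fun_cong [OF sum, of g]
      by (simp add: add_coeff zero_coeff)
    then show "x g = y g"
      using coeff_closed [OF x g] coeff_closed [OF y g] by simp
  qed
next
  assume "x = y"
  then show "x \<oplus>\<^bsub>A\<^esub> y = \<zero>\<^bsub>A\<^esub>"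
    using x by (intro algebra_eqI)
      (auto simp: add_coeff zero_coeff intro: char_2 coeff_closed add_closed zero_closed)
qed

text \<open>The annihilator of \<open>x\<close> is stable under right translations. As \<open>G\<close> is a 2-group, a nonzero
  annihilator would contain a nonzero constant function \<open>y\<close>; but then
  \<open>x y = augmentation x \<cdot> y = y\<close>.\<close>

lemma normalized_unit_annihilator:
  assumes x: "x \<in> V" and y: "y \<in> carrier A" and xy: "x \<otimes>\<^bsub>A\<^esub> y = \<zero>\<^bsub>A\<^esub>"
  shows "y = \<zero>\<^bsub>A\<^esub>"
proof (rule ccontr)
  assume "y \<noteq> \<zero>\<^bsub>A\<^esub>"
  note xA = normalized_unitsD(1) [OF x]
  define K where "K = {z \<in> carrier A. x \<otimes>\<^bsub>A\<^esub> z = \<zero>\<^bsub>A\<^esub>}"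
  \<comment> \<open>Right translation gives a left action: \<open>\<phi> g (\<phi> h z)\<close>
    evaluates \<open>z\<close> at the argument times \<open>g\<close> times
    \<open>h\<close>.\<close>
  define \<phi> where "\<phi> g z = (\<lambda>h\<in>carrier G. z (h \<otimes>\<^bsub>G\<^esub> g))" for g and z :: "'g \<Rightarrow> 'f"
  have K_fin: "finite K"
    using finite_algebra by (simp add: K_def)
  have \<phi>_closed: "\<phi> g z \<in> carrier A" if "g \<in> carrier G" "z \<in> carrier A" for g z
    using that by (auto simp: \<phi>_def carrier_algebra)
  have "group_action G K (\<lambda>g. \<lambda>z\<in>K. \<phi> g z)"
  proof (rule group_actionI)
    show "\<phi> g z \<in> K" if g: "g \<in> carrier G" and z: "z \<in> K" for g z
    proof -
      have zA: "z \<in> carrier A" and xz: "x \<otimes>\<^bsub>A\<^esub> z = \<zero>\<^bsub>A\<^esub>"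
        using z by (auto simp: K_def)
      have "x \<otimes>\<^bsub>A\<^esub> \<phi> g z = \<zero>\<^bsub>A\<^esub>"
      proof (rule algebra_eqI)
        fix h assume h: "h \<in> carrier G"
        have "(x \<otimes>\<^bsub>A\<^esub> \<phi> g z) h = (x \<otimes>\<^bsub>A\<^esub> z) (h \<otimes>\<^bsub>G\<^esub> g)"
          using g h by (subst (1 2) mult_coeff)
            (auto simp: \<phi>_def G.m_assoc coeff_closed [OF xA] coeff_closed [OF zA]
              intro!: F.finsum_cong')
        then show "(x \<otimes>\<^bsub>A\<^esub> \<phi> g z) h = \<zero>\<^bsub>A\<^esub> h"
          using g h xz by (simp add: zero_coeff)
      qed (intro mult_closed zero_closed \<phi>_closed xA zA g)+
      then show ?thesis
        using \<phi>_closed [OF g zA] by (simp add: K_def)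
    qed
    show "\<phi> \<one>\<^bsub>G\<^esub> z = z" if "z \<in> K" for z
      using that by (intro algebra_eqI \<phi>_closed) (auto simp: K_def \<phi>_def)
    show "\<phi> (g \<otimes>\<^bsub>G\<^esub> h) z = \<phi> g (\<phi> h z)" if "g \<in> carrier G" "h \<in> carrier G" for g h z
      using that by (auto simp: \<phi>_def G.m_assoc)
  qed (rule G.is_group)
  then interpret K: group_action G K "\<lambda>g. \<lambda>z\<in>K. \<phi> g z" .
  have yK: "y \<in> K"
    using y xy by (simp add: K_def)
  have zero_K: "\<zero>\<^bsub>A\<^esub> \<in> K"
    \<comment> \<open>Zero is written as \<open>y\<close> added to itself, so distributivity makes
      its product with \<open>x\<close> a doubled element.\<close>
    using xA mult_add [OF xA y y] add_eq_zero_iff [OF y y] add_eq_zero_iff [of "x \<otimes>\<^bsub>A\<^esub> y" "x \<otimes>\<^bsub>A\<^esub> y"]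
      mult_closed [OF xA y] by (simp add: K_def zero_closed)
  have "2 dvd card K"
  proof -
    have zero_add: "\<zero>\<^bsub>A\<^esub> \<oplus>\<^bsub>A\<^esub> \<zero>\<^bsub>A\<^esub> = \<zero>\<^bsub>A\<^esub>"
      using add_eq_zero_iff [OF zero_closed zero_closed] by simp
    show ?thesis
    \<comment> \<open>Adding the nonzero element \<open>y\<close> is a fixed-point-free involution
      of \<open>K\<close>.\<close>
    proof (rule even_card_involution [OF K_fin, of "\<lambda>z. z \<oplus>\<^bsub>A\<^esub> y"])
      fix z assume z: "z \<in> K"
      then have zA: "z \<in> carrier A"
        by (simp add: K_def)
      show "z \<oplus>\<^bsub>A\<^esub> y \<in> K"
        using z zA xA y xy mult_add [of x z y] zero_add by (simp add: K_def add_closed)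
      show "z \<oplus>\<^bsub>A\<^esub> y \<oplus>\<^bsub>A\<^esub> y = z"
        using zA y by (intro algebra_eqI add_closed)
          (auto simp: add_coeff coeff_closed F.a_assoc char_2)
      show "z \<oplus>\<^bsub>A\<^esub> y \<noteq> z"
      proof
        assume eq: "z \<oplus>\<^bsub>A\<^esub> y = z"
        have "y = \<zero>\<^bsub>A\<^esub>"
        proof (rule algebra_eqI [OF y zero_closed])
          fix g assume g: "g \<in> carrier G"
          have "z g \<oplus>\<^bsub>F\<^esub> y g = z g"
            using fun_cong [OF eq, of g] g by (simp add: add_coeff)
          then show "y g = \<zero>\<^bsub>A\<^esub> g"
            using g coeff_closed [OF zA g] coeff_closed [OF y g] by (simp add: zero_coeff)
        qed
        then show False
          using \<open>y \<noteq> \<zero>\<^bsub>A\<^esub>\<close> by simp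
      qed
    qed
  qed
  moreover obtain k where "order G = 2 ^ k"
    using order_G by blast
  \<comment> \<open>\<open>K - N\<close> is the set of fixed points. Since \<open>card K\<close> and
    \<open>card N\<close> are even, so is its size; as it contains zero, it contains a further
    element.\<close>
  moreover define N where "N = {z \<in> K. \<exists>g\<in>carrier G. (\<lambda>z\<in>K. \<phi> g z) z \<noteq> z}"
  ultimately have "2 dvd card N" "2 dvd card K"
    using K.prime_dvd_card_non_fixed_points [OF two_is_prime_nat _ K_fin] by auto
  moreover have "card (K - N) + card N = card K"
    using K_fin by (metis (no_types, lifting) N_def mem_Collect_eq subsetI card_Diff_subset
        card_mono finite_subset le_add_diff_inverse2)
  ultimately have "2 dvd card (K - N)"
    by (metis dvd_add_left_iff)
  moreover have "\<zero>\<^bsub>A\<^esub> \<in> K - N"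
  proof -
    have "\<phi> g \<zero>\<^bsub>A\<^esub> = \<zero>\<^bsub>A\<^esub>" if "g \<in> carrier G" for g
      using that by (intro algebra_eqI \<phi>_closed zero_closed) (simp_all add: \<phi>_def zero_coeff)
    then show ?thesis
      using zero_K by (simp add: N_def)
  qed
  ultimately have "K - N \<noteq> {\<zero>\<^bsub>A\<^esub>}"
    by force
  then obtain z where z: "z \<in> K - N" "z \<noteq> \<zero>\<^bsub>A\<^esub>"
    using \<open>\<zero>\<^bsub>A\<^esub> \<in> K - N\<close> by blast
  then have zA: "z \<in> carrier A" and xz: "x \<otimes>\<^bsub>A\<^esub> z = \<zero>\<^bsub>A\<^esub>"
    by (auto simp: K_def)
  \<comment> \<open>Invariance under the translation by \<open>g\<close>, read off at the
    identity.\<close>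
  have const: "z g = z \<one>\<^bsub>G\<^esub>" if g: "g \<in> carrier G" for g
  proof -
    have "\<phi> g z = z"
      using z g by (auto simp: N_def)
    then have "\<phi> g z \<one>\<^bsub>G\<^esub> = z \<one>\<^bsub>G\<^esub>"
      by simp
    then show ?thesis
      using g by (simp add: \<phi>_def)
  qed
  have "z = x \<otimes>\<^bsub>A\<^esub> z"
  proof (rule algebra_eqI)
    fix g assume g: "g \<in> carrier G"
    have z1: "z \<one>\<^bsub>G\<^esub> \<in> carrier F"
      using coeff_closed [OF zA] by simp
    have "(x \<otimes>\<^bsub>A\<^esub> z) g = (\<Oplus>\<^bsub>F\<^esub>h\<in>carrier G. x h \<otimes>\<^bsub>F\<^esub> z \<one>\<^bsub>G\<^esub>)"
      unfolding mult_coeff [OF g]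
    proof (rule F.finsum_cong')
      show "x h \<otimes>\<^bsub>F\<^esub> z (inv\<^bsub>G\<^esub> h \<otimes>\<^bsub>G\<^esub> g) = x h \<otimes>\<^bsub>F\<^esub> z \<one>\<^bsub>G\<^esub>" if "h \<in> carrier G" for h
        using const [of "inv\<^bsub>G\<^esub> h \<otimes>\<^bsub>G\<^esub> g"] that g by simp
    qed (auto simp: z1 coeff_closed [OF xA])
    also have "\<dots> = augmentation x \<otimes>\<^bsub>F\<^esub> z \<one>\<^bsub>G\<^esub>"
      using z1 finite_G by (subst F.finsum_ldistr) (auto simp: coeff_closed [OF xA])
    also have "\<dots> = z g"
      using const [OF g] z1 normalized_unitsD(2) [OF x] by simp
    finally show "z g = (x \<otimes>\<^bsub>A\<^esub> z) g" ..
  qed (intro mult_closed xA zA)+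
  then show False
    using xz z(2) by simp
qed

text \<open>With trivial annihilator, left multiplication by \<open>x\<close> is injective, hence
  surjective on the finite algebra, which gives a right inverse. Its augmentation is 1, so the
  argument can be repeated for it.\<close>

lemma normalized_unit_Units:
  assumes x: "x \<in> V"
  shows "x \<in> Units A"
proof -
  note xA = normalized_unitsD(1) [OF x]
  have right_inverse: "\<exists>y\<in>V. x \<otimes>\<^bsub>A\<^esub> y = \<one>\<^bsub>A\<^esub>" if x: "x \<in> V" for x
  proof -
    note xA = normalized_unitsD(1) [OF x]
    have "inj_on (\<lambda>y. x \<otimes>\<^bsub>A\<^esub> y) (carrier A)"
    proof (rule inj_onI)
      fix y z assume yz: "y \<in> carrier A" "z \<in> carrier A" "x \<otimes>\<^bsub>A\<^esub> y = x \<otimes>\<^bsub>A\<^esub> z"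
      then have "x \<otimes>\<^bsub>A\<^esub> (y \<oplus>\<^bsub>A\<^esub> z) = \<zero>\<^bsub>A\<^esub>"
        using xA by (simp add: mult_add add_eq_zero_iff mult_closed)
      then show "y = z"
        using normalized_unit_annihilator [OF x] yz add_eq_zero_iff add_closed by blast
    qed
    then have "(\<lambda>y. x \<otimes>\<^bsub>A\<^esub> y) ` carrier A = carrier A"
      using finite_algebra xA by (intro endo_inj_surj) (auto intro: mult_closed)
    then obtain y where y: "y \<in> carrier A" "x \<otimes>\<^bsub>A\<^esub> y = \<one>\<^bsub>A\<^esub>"
      using one_closed by (metis (no_types, lifting) image_iff)
    then have "augmentation y = \<one>\<^bsub>F\<^esub>"
      using augmentation_mult [OF xA y(1)] normalized_unitsD(2) [OF x] augmentation_one
        augmentation_closed [OF y(1)] by simp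
    then show ?thesis
      using y normalized_unitsI by blast
  qed
  obtain y where y: "y \<in> V" "x \<otimes>\<^bsub>A\<^esub> y = \<one>\<^bsub>A\<^esub>"
    using right_inverse [OF x] by blast
  obtain z where z: "z \<in> V" "y \<otimes>\<^bsub>A\<^esub> z = \<one>\<^bsub>A\<^esub>"
    using right_inverse [OF y(1)] by blast
  \<comment> \<open>\<open>y\<close> has left inverse \<open>x\<close> and right inverse
    \<open>z\<close>; these coincide, so \<open>y\<close> is a two-sided inverse of
    \<open>x\<close>.\<close>
  have "x = z"
    using A.inv_unique [of x y z] xA y z normalized_unitsD(1) by auto
  then show ?thesis
    using y z xA normalized_unitsD(1) [OF y(1)] by (auto simp: Units_def)
qed

lemma mult_normalized_units: "x \<in> V \<Longrightarrow> y \<in> V \<Longrightarrow> x \<otimes>\<^bsub>A\<^esub> y \<in> V"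
  by (intro normalized_unitsI)
    (auto simp: normalized_unitsD augmentation_mult intro: mult_closed dest: normalized_unitsD(1))

lemma inv_normalized_units:
  assumes x: "x \<in> V"
  shows "inv\<^bsub>A\<^esub> x \<in> V"
proof (rule normalized_unitsI)
  note u = normalized_unit_Units [OF x]
  show c: "inv\<^bsub>A\<^esub> x \<in> carrier A"
    using A.Units_inv_closed [OF u] .
  show "augmentation (inv\<^bsub>A\<^esub> x) = \<one>\<^bsub>F\<^esub>"
    using augmentation_mult [OF normalized_unitsD(1) [OF x] c] A.Units_r_inv [OF u]
      normalized_unitsD(2) [OF x] augmentation_closed [OF c] augmentation_one by simp
qed

section \<open>Norms and their fibres\<close>

text \<open>Since \<open>x\<close> is a unit, a one-sided equation already determines its
  inverse.\<close>

lemma unitary_iff: "x \<in> unitary_subgroup F G \<longleftrightarrow> x \<in> V \<and> x \<otimes>\<^bsub>A\<^esub> star G x = \<one>\<^bsub>A\<^esub>"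
proof -
  have "star G x = inv\<^bsub>A\<^esub> x \<longleftrightarrow> x \<otimes>\<^bsub>A\<^esub> star G x = \<one>\<^bsub>A\<^esub>" if x: "x \<in> V"
  proof
    note u = normalized_unit_Units [OF x] and xA = normalized_unitsD(1) [OF x]
    show "x \<otimes>\<^bsub>A\<^esub> star G x = \<one>\<^bsub>A\<^esub>" if "star G x = inv\<^bsub>A\<^esub> x"
      using that u by simp
    show "star G x = inv\<^bsub>A\<^esub> x" if "x \<otimes>\<^bsub>A\<^esub> star G x = \<one>\<^bsub>A\<^esub>"
      using that u xA star_closed [OF xA]
      by (metis A.Units_inv_closed A.Units_l_inv A.inv_unique)
  qed
  then show ?thesis
    by (auto simp: unitary_subgroup_def)
qed

lemma finite_normalized_units: "finite V"
  using finite_algebra by (rule rev_finite_subset) (auto dest: normalized_unitsD)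

definition norm_map where "norm_map x = x \<otimes>\<^bsub>A\<^esub> star G x"

text \<open>The right-hand side depends on \<open>y\<close> only through its norm, so right factors
  of equal norm are interchangeable.\<close>

lemma norm_map_mult:
  assumes "x \<in> carrier A" "y \<in> carrier A"
  shows "norm_map (x \<otimes>\<^bsub>A\<^esub> y) = x \<otimes>\<^bsub>A\<^esub> norm_map y \<otimes>\<^bsub>A\<^esub> star G x"
  using assms by (simp add: norm_map_def star_mult star_closed A.m_assoc)

text \<open>A unitary right factor has norm one and drops out of \<open>norm_map_mult\<close>.
  Conversely, if \<open>x\<close> and \<open>y\<close> have equal norms, the inverse of
  \<open>y\<close> times \<open>x\<close> has norm one.\<close>

lemma norm_map_fibre:
  assumes y: "y \<in> V"
  shows "{x \<in> V. norm_map x = norm_map y} = (\<lambda>u. y \<otimes>\<^bsub>A\<^esub> u) ` unitary_subgroup F G"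
proof (intro equalityI subsetI)
  note u = normalized_unit_Units [OF y] and yA = normalized_unitsD(1) [OF y]
  show "x \<in> {x \<in> V. norm_map x = norm_map y}"
    if x: "x \<in> (\<lambda>u. y \<otimes>\<^bsub>A\<^esub> u) ` unitary_subgroup F G" for x
  proof -
    obtain v where v: "v \<in> V" "norm_map v = \<one>\<^bsub>A\<^esub>" "x = y \<otimes>\<^bsub>A\<^esub> v"
      using x by (auto simp: unitary_iff norm_map_def)
    have "norm_map x = norm_map y"
      using yA normalized_unitsD(1) [OF v(1)] v(2,3) norm_map_mult [of y v]
      by (simp add: norm_map_def)
    then show ?thesis
      using v y by (simp add: mult_normalized_units)
  qed
  fix x assume "x \<in> {x \<in> V. norm_map x = norm_map y}"
  then have x: "x \<in> V" "norm_map x = norm_map y"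
    by auto
  note xA = normalized_unitsD(1) [OF x(1)] and c = A.Units_inv_closed [OF u]
  have "norm_map (inv\<^bsub>A\<^esub> y \<otimes>\<^bsub>A\<^esub> x) = norm_map (inv\<^bsub>A\<^esub> y \<otimes>\<^bsub>A\<^esub> y)"
    using x(2) xA yA c by (simp add: norm_map_mult)
  also have "\<dots> = \<one>\<^bsub>A\<^esub>"
    using u by (simp add: norm_map_def star_one)
  finally have "inv\<^bsub>A\<^esub> y \<otimes>\<^bsub>A\<^esub> x \<in> unitary_subgroup F G"
    using x(1) y by (simp add: unitary_iff mult_normalized_units inv_normalized_units norm_map_def)
  moreover have "x = y \<otimes>\<^bsub>A\<^esub> (inv\<^bsub>A\<^esub> y \<otimes>\<^bsub>A\<^esub> x)"
    using u xA yA c by (simp add: A.m_assoc [symmetric])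
  ultimately show "x \<in> (\<lambda>u. y \<otimes>\<^bsub>A\<^esub> u) ` unitary_subgroup F G"
    by blast
qed

text \<open>Sorting \<open>V\<close> by norm gives fibres of equal size, because left multiplication
  by a unit is injective.\<close>

lemma card_unitary_norm_map:
  "card (unitary_subgroup F G) * card (norm_map ` V) = card V"
proof -
  have "card V = (\<Sum>y\<in>norm_map ` V. card {x \<in> V. norm_map x = y})"
    using finite_normalized_units sum.image_gen [of V "\<lambda>_. 1::nat" norm_map] by simp
  also have "\<dots> = (\<Sum>y\<in>norm_map ` V. card (unitary_subgroup F G))"
  proof (rule sum.cong)
    fix z assume "z \<in> norm_map ` V"
    then obtain y where y: "y \<in> V" "z = norm_map y"
      by blast
    have "unitary_subgroup F G \<subseteq> carrier A"
      by (auto simp: unitary_iff dest: normalized_unitsD)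
    then have "inj_on (\<lambda>u. y \<otimes>\<^bsub>A\<^esub> u) (unitary_subgroup F G)"
      using A.Units_l_cancel [OF normalized_unit_Units [OF y(1)]] by (auto intro!: inj_onI)
    then show "card {x \<in> V. norm_map x = z} = card (unitary_subgroup F G)"
      using norm_map_fibre [OF y(1)] y(2) by (simp add: card_image)
  qed simp
  finally show ?thesis
    by simp
qed

section \<open>Coefficients of norms\<close>

lemma norm_map_closed: "x \<in> carrier A \<Longrightarrow> norm_map x \<in> carrier A"
  by (simp add: norm_map_def star_closed)

lemma star_norm_map: "x \<in> carrier A \<Longrightarrow> star G (norm_map x) = norm_map x"
  by (simp add: norm_map_def star_mult star_star star_closed)

lemma norm_map_coeff:
  assumes x: "x \<in> carrier A" and g: "g \<in> carrier G"
  shows "norm_map x g = (\<Oplus>\<^bsub>F\<^esub>h\<in>carrier G. x h \<otimes>\<^bsub>F\<^esub> x (inv\<^bsub>G\<^esub> g \<otimes>\<^bsub>G\<^esub> h))"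
  unfolding norm_map_def mult_coeff [OF g] using g coeff_closed [OF x]
  by (intro F.finsum_cong') (auto simp: star_coeff G.inv_mult_group)

text \<open>At the identity the convolution becomes a sum of squares, hence the square of the
  augmentation.\<close>

lemma norm_map_coeff_one:
  assumes x: "x \<in> V"
  shows "norm_map x \<one>\<^bsub>G\<^esub> = \<one>\<^bsub>F\<^esub>"
proof -
  note c = coeff_closed [OF normalized_unitsD(1) [OF x]]
  have "norm_map x \<one>\<^bsub>G\<^esub> = (\<Oplus>\<^bsub>F\<^esub>h\<in>carrier G. x h \<otimes>\<^bsub>F\<^esub> x h)"
    unfolding norm_map_coeff [OF normalized_unitsD(1) [OF x] G.one_closed]
    using c by (intro F.finsum_cong') auto
  also have "\<dots> = augmentation x \<otimes>\<^bsub>F\<^esub> augmentation x"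
    using c by (intro F.finsum_square_char_2 char_2 finite_G) auto
  finally show ?thesis
    using normalized_unitsD(2) [OF x] by simp
qed

text \<open>Presents \<open>Omega1 G\<close> as the fixed set of inversion, the form needed for
  pairing \<open>g\<close> with its inverse.\<close>

lemma Omega1_iff: "g \<in> Omega1 G \<longleftrightarrow> g \<in> carrier G \<and> inv\<^bsub>G\<^esub> g = g"
proof -
  have "g [^]\<^bsub>G\<^esub> (2::nat) = \<one>\<^bsub>G\<^esub> \<longleftrightarrow> inv\<^bsub>G\<^esub> g = g" if g: "g \<in> carrier G"
    using g G.inv_equality [of g g] by (auto simp: numeral_2_eq_2) (metis G.l_inv)
  then show ?thesis
    by (auto simp: Omega1_def)
qed

text \<open>Left translation by \<open>g\<close> is a fixed-point-free involution of
  \<open>G\<close> that exchanges the two factors of each summand, so the summands cancel in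
  pairs.\<close>

lemma norm_map_coeff_involution:
  assumes x: "x \<in> carrier A" and g: "g \<in> Omega1 G" "g \<noteq> \<one>\<^bsub>G\<^esub>"
  shows "norm_map x g = \<zero>\<^bsub>F\<^esub>"
proof -
  have gG: "g \<in> carrier G" and inv: "inv\<^bsub>G\<^esub> g = g"
    using g by (auto simp: Omega1_iff)
  have gg: "g \<otimes>\<^bsub>G\<^esub> (g \<otimes>\<^bsub>G\<^esub> h) = h" if "h \<in> carrier G" for h
    using G.l_inv [OF gG] gG that by (simp add: inv G.m_assoc [symmetric])
  show ?thesis
    unfolding norm_map_coeff [OF x gG] inv
  proof (rule F.finsum_involution_eq_zero [where \<sigma> = "\<lambda>h. g \<otimes>\<^bsub>G\<^esub> h"])
    show "g \<otimes>\<^bsub>G\<^esub> h \<noteq> h" if "h \<in> carrier G" for h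
      using g(2) gG that by simp
    show "x (g \<otimes>\<^bsub>G\<^esub> h) \<otimes>\<^bsub>F\<^esub> x (g \<otimes>\<^bsub>G\<^esub> (g \<otimes>\<^bsub>G\<^esub> h)) = x h \<otimes>\<^bsub>F\<^esub> x (g \<otimes>\<^bsub>G\<^esub> h)"
      if "h \<in> carrier G" for h
      using gg [OF that] gG that coeff_closed [OF x] by (simp add: F.m_comm)
  qed (use gG gg coeff_closed [OF x] finite_G char_2 in auto)
qed

section \<open>Counting norms by inverse pairs\<close>

text \<open>Index set for the coefficients that determine a norm; outside \<open>Omega1 G\<close>
  each pair has two distinct members.\<close>

definition inverse_pairs :: "'g set set" where
  "inverse_pairs = (\<lambda>g. {g, inv\<^bsub>G\<^esub> g}) ` (carrier G - Omega1 G)"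

lemma finite_inverse_pairs: "finite inverse_pairs"
  using finite_G by (simp add: inverse_pairs_def)

lemma order_eq_inverse_pairs: "order G = card (Omega1 G) + 2 * card inverse_pairs"
proof -
  have sub: "Omega1 G \<subseteq> carrier G"
    by (auto simp: Omega1_def)
  have inv_closed: "inv\<^bsub>G\<^esub> g \<in> carrier G - Omega1 G" if "g \<in> carrier G - Omega1 G" for g
    using that by (auto simp: Omega1_iff)
  then have Union: "\<Union> inverse_pairs = carrier G - Omega1 G"
    by (auto simp: inverse_pairs_def)
  have "2 * card inverse_pairs = card (\<Union> inverse_pairs)"
  proof (rule card_partition)
    show "card p = 2" if "p \<in> inverse_pairs" for p
      using that by (auto simp: inverse_pairs_def Omega1_iff dest: not_sym)
    show "p \<inter> q = {}" if "p \<in> inverse_pairs" "q \<in> inverse_pairs" "p \<noteq> q" for p q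
      using that by (auto simp: inverse_pairs_def)
  qed (use finite_G Union finite_inverse_pairs in auto)
  then show ?thesis
    using card_Diff_subset [OF finite_subset [OF sub finite_G] sub] card_mono [OF finite_G sub]
    by (simp add: Union order_def)
qed

text \<open>Norms agree on \<open>Omega1 G\<close> and are symmetric elsewhere, so recording one
  coefficient per inverse pair is injective.\<close>

lemma card_norm_map_le: "card (norm_map ` V) \<le> card (carrier F) ^ card inverse_pairs"
proof -
  \<comment> \<open>The choice within a pair is immaterial, since a norm takes the same value at
    both members.\<close>
  define rep where "rep p = (SOME g. g \<in> p)" for p :: "'g set"
  have rep: "rep p \<in> p" if "p \<in> inverse_pairs" for p
    using that unfolding rep_def inverse_pairs_def by (intro someI_ex [of "\<lambda>g. g \<in> p"]) auto
  have pair_sub: "p \<subseteq> carrier G" if "p \<in> inverse_pairs" for p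
    using that by (auto simp: inverse_pairs_def)
  have "inj_on (\<lambda>y. \<lambda>p\<in>inverse_pairs. y (rep p)) (norm_map ` V)"
  proof (rule inj_onI)
    fix y z
    assume y: "y \<in> norm_map ` V" and z: "z \<in> norm_map ` V"
      and eq: "(\<lambda>p\<in>inverse_pairs. y (rep p)) = (\<lambda>p\<in>inverse_pairs. z (rep p))"
    obtain a b where a: "a \<in> V" "y = norm_map a" and b: "b \<in> V" "z = norm_map b"
      using y z by blast
    note aA = normalized_unitsD(1) [OF a(1)] and bA = normalized_unitsD(1) [OF b(1)]
    show "y = z"
    proof (rule algebra_eqI)
      fix g assume g: "g \<in> carrier G"
      consider "g = \<one>\<^bsub>G\<^esub>" | "g \<in> Omega1 G" "g \<noteq> \<one>\<^bsub>G\<^esub>" | "g \<notin> Omega1 G"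
        by blast
      then show "y g = z g"
      proof cases
        case 1
        then show ?thesis
          using a b norm_map_coeff_one by simp
      next
        case 2
        then show ?thesis
          using a b norm_map_coeff_involution [OF aA] norm_map_coeff_involution [OF bA] by simp
      next
        case 3
        then have p: "{g, inv\<^bsub>G\<^esub> g} \<in> inverse_pairs"
          using g by (auto simp: inverse_pairs_def)
        have sym: "y (inv\<^bsub>G\<^esub> g) = y g" "z (inv\<^bsub>G\<^esub> g) = z g"
          using star_norm_map [OF aA] star_norm_map [OF bA] a(2) b(2) star_coeff [OF g] by metis+
        have "rep {g, inv\<^bsub>G\<^esub> g} = g \<or> rep {g, inv\<^bsub>G\<^esub> g} = inv\<^bsub>G\<^esub> g"
          using rep [OF p] by blast
        then show ?thesis
          using fun_cong [OF eq, of "{g, inv\<^bsub>G\<^esub> g}"] p sym by auto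
      qed
    qed (use a b aA bA norm_map_closed in auto)
  qed
  moreover have "(\<lambda>y. \<lambda>p\<in>inverse_pairs. y (rep p)) ` (norm_map ` V) \<subseteq> inverse_pairs \<rightarrow>\<^sub>E carrier F"
  proof -
    have "norm_map a (rep p) \<in> carrier F" if "a \<in> V" "p \<in> inverse_pairs" for a p
      using that rep pair_sub coeff_closed norm_map_closed normalized_unitsD(1) by blast
    then show ?thesis
      by (simp add: image_subset_iff restrict_PiE_iff del: restrict_apply)
  qed
  ultimately have "card (norm_map ` V) \<le> card (inverse_pairs \<rightarrow>\<^sub>E carrier F)"
    using finite_F finite_inverse_pairs by (intro card_inj_on_le) (auto intro: finite_PiE)
  then show ?thesis
    using finite_inverse_pairs by (simp add: card_funcsetE)
qed

section \<open>Comparison of exponents of 2\<close>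

lemma card_field_power_of_2: "\<exists>f. card (carrier F) = 2 ^ f"
  using group.order_power_of_2 [OF F.a_group] finite_F char_2 by (simp add: order_def)

text \<open>With all cardinalities powers of 2, divisibility compares exponents:
  \<open>a + c\<close> is known and \<open>c\<close> is bounded above, which bounds \<open>a\<close>
  below.\<close>

theorem unitary_subgroup_card_dvd:
  "card (carrier F) ^ ((order G + card (Omega1 G)) div 2 - 1) dvd card (unitary_subgroup F G)"
proof -
  obtain f where f: "card (carrier F) = 2 ^ f"
    using card_field_power_of_2 by blast
  have prod: "card (unitary_subgroup F G) * card (norm_map ` V) = 2 ^ (f * (order G - 1))"
    using card_unitary_norm_map card_normalized_units f by (simp add: power_mult)
  \<comment> \<open>Both factors divide a power of 2, so they are powers of 2 themselves.\<close>
  then obtain a c where a: "card (unitary_subgroup F G) = 2 ^ a" and c: "card (norm_map ` V) = 2 ^ c"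
    using divides_primepow_nat [OF two_is_prime_nat] by (metis dvd_triv_left dvd_triv_right)
  have "(2::nat) ^ (a + c) = 2 ^ (f * (order G - 1))"
    using prod a c by (simp add: power_add)
  then have ac: "a + c = f * (order G - 1)"
    by simp
  have "(2::nat) ^ c \<le> 2 ^ (f * card inverse_pairs)"
    using card_norm_map_le f c by (simp add: power_mult)
  then have c_le: "c \<le> f * card inverse_pairs"
    by simp
  have "\<one>\<^bsub>G\<^esub> \<in> Omega1 G"
    by (simp add: Omega1_iff)
  moreover have "finite (Omega1 G)"
    using finite_G by (simp add: Omega1_def)
  ultimately have pos: "card (Omega1 G) > 0"
    using card_gt_0_iff by blast
  let ?e = "(order G + card (Omega1 G)) div 2 - 1"
  \<comment> \<open>By \<open>order_eq_inverse_pairs\<close> the halving in \<open>?e\<close> is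
    exact, and \<open>pos\<close> keeps the subtractions of 1 from truncating.\<close>
  have "order G - 1 = ?e + card inverse_pairs"
    using order_eq_inverse_pairs pos by simp
  then have "f * ?e \<le> a"
    using ac c_le by (simp add: algebra_simps)
  then show ?thesis
    using f a by (simp add: le_imp_power_dvd flip: power_mult)
qed

end

theorem corollary4p21:
  fixes F :: "('f, 'a) ring_scheme"
    and G :: "('g, 'b) monoid_scheme"
    and \<iota> :: "int \<times> int \<Rightarrow> 'g"
    and \<pi> :: "'g \<Rightarrow> nat \<Rightarrow> int"
    and n m r k :: nat
  assumes "field F" "finite (carrier F)" "ring_characteristic F = 2"
    and "1 \<le> m" "m \<le> n"
    and "group G" "finite (carrier G)" "order G = 2 ^ k" "\<not> comm_group G"
    and "central_extension
           (integer_mod_group (2 ^ n) \<times>\<times> integer_mod_group (2 ^ m))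
           G
           (product_group {..<r} (\<lambda>_. integer_mod_group 2))
           \<iota> \<pi>"
    and "G\<lparr>carrier := derived G (carrier G)\<rparr> \<cong> integer_mod_group 2"
  shows "card (carrier F) ^ ((order G + card (Omega1 G)) div 2 - 1)
           dvd card (unitary_subgroup F G)"
proof -
  interpret F: field F by fact
  interpret G: group G by fact
  \<comment> \<open>\<open>add_self_char_2\<close> turns the hypothesis on
    \<open>ring_characteristic\<close> into \<open>char_2\<close>, and \<open>k\<close> is the
    witness for \<open>order_G\<close>.\<close>
  interpret finite_group_algebra_char_2 F G
    using assms(2,3,7,8) by unfold_locales (auto intro: F.add_self_char_2)
  show ?thesis
    by (rule unitary_subgroup_card_dvd)
qed

end
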